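(* Assume that $A$ is a subset of an infinite-dimensional Banach space $E$ such that the linear span $\operatorname{span} A$ (with the topology inherited from $E$) is barrelled. Then $|A|\ge\operatorname{cov}(\mathcal{N})$.
   Context: A topological vector space is barrelled if every absolutely convex closed absorbing subset of it (a barrel) is a neighborhood of $0$. $\mathcal{N}$ is the ideal of Lebesgue null sets, and $\operatorname{cov}(\mathcal{N})$ is the minimal cardinality of a family of Lebesgue null sets whose union is the interval $[0,1]$.
   Formalization: The formal theorem additionally assumes that span A is infinite-dimensional; without this the claim fails, e.g. for a one-element set A, whose span is finite-dimensional and hence barrelled. *)

theory Defs
  imports "HOL-Analysis.Analysis"
begin

unbundle cardinal_syntax

section \<open>Real and complex normed spaces\<close>

text \<open>
  The sort \<open>{real_normed_field, euclidean_space}\<close> is the library's way of saying that the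
  scalar field is the real or the complex numbers. The class \<open>banach\<close> only provides real scalars,
  so a Banach space over the scalar field \<open>'k\<close> is a type of class \<open>banach\<close> together with a scalar
  multiplication by \<open>'k\<close> that extends the real one and for which the norm is homogeneous.
\<close>

locale normed_vector_space = vector_space smul
  for smul :: "'k::{real_normed_field, euclidean_space} \<Rightarrow> 'a::real_normed_vector \<Rightarrow> 'a" +
  assumes norm_scale: "norm (smul c x) = norm c * norm x"
    and scale_of_real: "smul (of_real r) x = r *\<^sub>R x"

lemma normed_vector_space_real:
  "normed_vector_space ((*\<^sub>R) :: real \<Rightarrow> 'a \<Rightarrow> 'a::real_normed_vector)"
  by unfold_locales (auto simp: algebra_simps)

lemma normed_vector_space_complex: "normed_vector_space ((*) :: complex \<Rightarrow> complex \<Rightarrow> complex)"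
  by unfold_locales (auto simp: algebra_simps norm_mult scaleR_conv_of_real)

definition infinite_dimensional ::
  "('k::field \<Rightarrow> 'a::ab_group_add \<Rightarrow> 'a) \<Rightarrow> 'a set \<Rightarrow> bool"
  where "infinite_dimensional smul S \<longleftrightarrow> \<not> (\<exists>B. finite B \<and> S \<subseteq> module.span smul B)"

section \<open>Barrelled spaces\<close>

text \<open>
  The topological vector space is given by a topology \<open>T\<close> whose carrier \<open>topspace T\<close> is a linear
  subspace of the type \<open>'a\<close>; all notions are relative to that carrier.
\<close>

definition absolutely_convex ::
  "('k::real_normed_field \<Rightarrow> 'a::ab_group_add \<Rightarrow> 'a) \<Rightarrow> 'a set \<Rightarrow> bool"
  where "absolutely_convex smul B \<longleftrightarrow>
    (\<forall>x\<in>B. \<forall>y\<in>B. \<forall>a b. norm a + norm b \<le> 1 \<longrightarrow> smul a x + smul b y \<in> B)"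

definition absorbing_in ::
  "('k::real_normed_field \<Rightarrow> 'a::ab_group_add \<Rightarrow> 'a) \<Rightarrow> 'a set \<Rightarrow> 'a set \<Rightarrow> bool"
  where "absorbing_in smul S B \<longleftrightarrow> (\<forall>x\<in>S. \<exists>r>0. \<forall>c. norm c \<le> r \<longrightarrow> smul c x \<in> B)"

definition barrel ::
  "('k::real_normed_field \<Rightarrow> 'a::ab_group_add \<Rightarrow> 'a) \<Rightarrow> 'a topology \<Rightarrow> 'a set \<Rightarrow> bool"
  where "barrel smul T B \<longleftrightarrow>
    closedin T B \<and> absolutely_convex smul B \<and> absorbing_in smul (topspace T) B"

definition barrelled ::
  "('k::real_normed_field \<Rightarrow> 'a::ab_group_add \<Rightarrow> 'a) \<Rightarrow> 'a topology \<Rightarrow> bool"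
  where "barrelled smul T \<longleftrightarrow>
    (\<forall>B. barrel smul T B \<longrightarrow> (\<exists>U. openin T U \<and> 0 \<in> U \<and> U \<subseteq> B))"

section \<open>The covering number of the null ideal\<close>

definition null_covers :: "real set set set"
  where "null_covers = {F. F \<subseteq> null_sets lebesgue \<and> \<Union>F = {0..1}}"

text \<open>
  The choice is unique only up to \<open>=o\<close>, so \<open>cov_null\<close> should only be used through the
  cardinal comparisons \<open>\<le>o\<close>, \<open><o\<close> and \<open>=o\<close>.
\<close>

definition cov_null :: "real set rel"
  where "cov_null = (SOME r. \<exists>F\<in>null_covers. r = |F| \<and> (\<forall>G\<in>null_covers. |F| \<le>o |G| ))"

lemma null_covers_nonempty: "null_covers \<noteq> {}"
proof -
  have "(\<lambda>x. {x}) ` {0..1::real} \<in> null_covers"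
    by (auto simp: null_covers_def intro: null_sets_completionI)
  then show ?thesis by blast
qed

lemma cov_null_minimal: "\<exists>F\<in>null_covers. cov_null = |F| \<and> (\<forall>G\<in>null_covers. |F| \<le>o |G| )"
proof -
  have "\<exists>r\<in>card_of ` null_covers. \<forall>r'\<in>card_of ` null_covers. r \<le>o r'"
    using null_covers_nonempty by (intro exists_minim_Card_order) (auto simp: card_of_Card_order)
  then have "\<exists>r. \<exists>F\<in>null_covers. r = |F| \<and> (\<forall>G\<in>null_covers. |F| \<le>o |G| )" by auto
  then show ?thesis unfolding cov_null_def by (rule someI_ex)
qed

end

theory Submission
  imports Defs
begin

text \<open>
  Barrelled spaces satisfy the uniform boundedness principle. It therefore suffices to show: if
  \<open>A\<close> has fewer than \<open>cov(N)\<close> elements and \<open>L = span A\<close> is infinite-dimensional, then there are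
  functionals that are bounded at each point of \<open>A\<close> while their norms on \<open>L\<close> are unbounded. Such
  functionals are chosen at random. If for each single \<open>a\<close> the random choice fails only on a null
  set of parameters \<open>\<omega> \<in> [0,1]\<close>, then fewer than \<open>cov(N)\<close> null sets have to be avoided, and some
  \<open>\<omega>\<close> works for all points of \<open>A\<close> at once. In other words, if \<open>L\<close> is barrelled, these null sets
  cover the interval.

  The random choice rests on a geometric fact about every infinite-dimensional normed space \<open>L\<close>
  (\<open>few_large_functionals\<close>): for every \<open>\<epsilon> > 0\<close> there are finitely many functionals of norm 1 on
  \<open>L\<close> such that for each \<open>a \<in> L\<close> all but a fraction \<open>\<epsilon>\<close> of them have modulus at most
  \<open>\<epsilon> * norm a\<close> at \<open>a\<close>. Picking uniformly one functional from the family for \<open>\<epsilon> = 1 / 2 ^ k\<close> and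
  multiplying it by \<open>2 ^ k\<close> gives norm \<open>2 ^ k\<close>, whereas by the Borel-Cantelli lemma
  (\<open>recurrent_rare_cells_null\<close>) almost surely all but finitely many of the values at \<open>a\<close> are
  bounded by \<open>norm a\<close>.

  For a Hilbert space the coordinate functionals of \<open>\<lceil>1 / \<epsilon>\<^sup>3\<rceil>\<close> orthonormal vectors would do, and
  Dvoretzky's theorem would transfer this to every space. A softer argument is enough. By
  trace duality, for any probability measure on the unit ball of \<open>L\<close> a space of functionals of
  dimension greater than \<open>1 / \<epsilon>\<close> contains one of norm 1 whose mean square is at most \<open>\<epsilon>\<close>
  (\<open>exists_small_in_mean\<close>). By a minimax argument the order of the choices may be reversed: there
  is a finite distribution of functionals whose mean square is small at every point of the unit
  ball (\<open>multiplicative_weights\<close>, \<open>spread_functionals\<close>). The functionals come from a triangular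
  system built with the Hahn-Banach theorem (\<open>triangular_system_exists\<close>), which also provides the
  compactness that reduces the unit ball to a finite net.

  All this is done over the reals; the scalar field enters in the uniform boundedness principle
  \<open>barrelled_uniform_boundedness\<close> and through the finitely many multiples \<open>smul b a\<close> of each
  \<open>a \<in> A\<close>, with \<open>b\<close> in a real basis of the field.
\<close>

section \<open>Norming functionals\<close>

definition sublinear :: "('a::real_vector \<Rightarrow> real) \<Rightarrow> bool"
  where "sublinear q \<longleftrightarrow>
    (\<forall>x y. q (x + y) \<le> q x + q y) \<and> (\<forall>t x. 0 \<le> t \<longrightarrow> q (t *\<^sub>R x) = t * q x)"

lemma sublinear_add: "sublinear q \<Longrightarrow> q (x + y) \<le> q x + q y"
  and sublinear_scale: "sublinear q \<Longrightarrow> 0 \<le> t \<Longrightarrow> q (t *\<^sub>R x) = t * q x"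
  by (auto simp: sublinear_def)

lemma sublinear_zero: "sublinear q \<Longrightarrow> q 0 = 0"
  using sublinear_scale[of q 0 0] by simp

lemma sublinear_ge_minus: "sublinear q \<Longrightarrow> - q (- x) \<le> q x"
  using sublinear_add[of q x "- x"] by (simp add: sublinear_zero)

text \<open>
  The pointwise infimum of a family is sublinear as soon as the family is directed enough:
  the right-hand side of subadditivity involves two members, which a third one must absorb, and
  likewise for positive scaling. Chains and the families of the next lemma are both of this kind.
\<close>
lemma sublinear_INF:
  fixes q :: "'i \<Rightarrow> 'a::real_vector \<Rightarrow> real"
  assumes "I \<noteq> {}"
    and bdd: "\<And>x. bdd_below ((\<lambda>i. q i x) ` I)"
    and add: "\<And>i j x y. i \<in> I \<Longrightarrow> j \<in> I \<Longrightarrow> \<exists>k\<in>I. q k (x + y) \<le> q i x + q j y"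
    and scale: "\<And>i t x. i \<in> I \<Longrightarrow> 0 < t \<Longrightarrow> \<exists>k\<in>I. q k (t *\<^sub>R x) \<le> t * q i x"
    and zero: "\<And>i. i \<in> I \<Longrightarrow> q i 0 = 0"
  shows "sublinear (\<lambda>x. INF i\<in>I. q i x)"
proof -
  let ?r = "\<lambda>x. INF i\<in>I. q i x"
  have lower: "?r x \<le> q i x" if "i \<in> I" for i x
    using bdd that by (rule cINF_lower)
  have "?r (x + y) \<le> ?r x + ?r y" for x y
  proof -
    have "?r (x + y) - q i x \<le> ?r y" if i: "i \<in> I" for i
    proof (rule cINF_greatest[OF \<open>I \<noteq> {}\<close>])
      fix j assume "j \<in> I"
      then obtain k where "k \<in> I" "q k (x + y) \<le> q i x + q j y"
        using add i by blast
      then show "?r (x + y) - q i x \<le> q j y"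
        using lower[of k "x + y"] by simp
    qed
    then have "?r (x + y) - ?r y \<le> ?r x"
      by (intro cINF_greatest[OF \<open>I \<noteq> {}\<close>]) (auto simp: algebra_simps)
    then show ?thesis by simp
  qed
  moreover have "?r (t *\<^sub>R x) = t * ?r x" if "0 \<le> t" for t x
  proof (cases "t = 0")
    case True
    then show ?thesis using zero \<open>I \<noteq> {}\<close> by simp
  next
    case False
    have le: "?r (s *\<^sub>R z) \<le> s * ?r z" if "0 < s" for s z
    proof -
      have "?r (s *\<^sub>R z) / s \<le> ?r z"
      proof (rule cINF_greatest[OF \<open>I \<noteq> {}\<close>])
        fix i assume "i \<in> I"
        then obtain k where "k \<in> I" "q k (s *\<^sub>R z) \<le> s * q i z"
          using scale \<open>0 < s\<close> by blast
        then show "?r (s *\<^sub>R z) / s \<le> q i z"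
          using lower[of k "s *\<^sub>R z"] \<open>0 < s\<close> by (simp add: field_simps)
      qed
      then show ?thesis using \<open>0 < s\<close> by (simp add: field_simps)
    qed
    have "?r x \<le> inverse t * ?r (t *\<^sub>R x)"
      using le[of "inverse t" "t *\<^sub>R x"] False that by simp
    then show ?thesis
      using le[of t x] False that by (simp add: field_simps)
  qed
  ultimately show ?thesis by (simp add: sublinear_def)
qed

text \<open>
  The functional \<open>r\<close> lies below \<open>q\<close> (take \<open>t = 0\<close>) and satisfies \<open>r (- y) \<le> - q y\<close> (take
  \<open>t = 1\<close>), so that a linear functional below \<open>r\<close> agrees with \<open>q\<close> at \<open>y\<close>. It serves twice: to
  see that a minimal sublinear functional is linear, and to make the linear functional norming.
\<close>
lemma sublinear_tilt:
  fixes q :: "'a::real_vector \<Rightarrow> real" and y :: 'a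
  assumes q: "sublinear q"
  defines "r \<equiv> \<lambda>x. INF t\<in>{0..}. q (x + t *\<^sub>R y) - t * q y"
  shows "sublinear r" and "\<And>x t. 0 \<le> t \<Longrightarrow> r x \<le> q (x + t *\<^sub>R y) - t * q y"
proof -
  have bdd: "bdd_below ((\<lambda>t. q (x + t *\<^sub>R y) - t * q y) ` {0..})" for x
  proof (rule bdd_belowI2)
    fix t :: real assume "t \<in> {0..}"
    then show "- q (- x) \<le> q (x + t *\<^sub>R y) - t * q y"
      using sublinear_add[OF q, of "x + t *\<^sub>R y" "- x"] sublinear_scale[OF q, of t y] by simp
  qed
  show "r x \<le> q (x + t *\<^sub>R y) - t * q y" if "0 \<le> t" for x t
    unfolding r_def using that by (intro cINF_lower[OF bdd]) auto
  show "sublinear r" unfolding r_def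
  proof (rule sublinear_INF[OF _ bdd])
    fix s t :: real and x z assume "s \<in> {0..}" "t \<in> {0..}"
    then show "\<exists>k\<in>{0..}. q (x + z + k *\<^sub>R y) - k * q y
        \<le> (q (x + s *\<^sub>R y) - s * q y) + (q (z + t *\<^sub>R y) - t * q y)"
      using sublinear_add[OF q, of "x + s *\<^sub>R y" "z + t *\<^sub>R y"]
      by (intro bexI[of _ "s + t"]) (auto simp: algebra_simps)
  next
    fix s t :: real and x assume "s \<in> {0..}" "0 < t"
    then show "\<exists>k\<in>{0..}. q (t *\<^sub>R x + k *\<^sub>R y) - k * q y \<le> t * (q (x + s *\<^sub>R y) - s * q y)"
      using sublinear_scale[OF q, of t "x + s *\<^sub>R y"]
      by (intro bexI[of _ "t * s"]) (auto simp: algebra_simps)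
  next
    fix s :: real assume "s \<in> {0..}"
    then show "q (0 + s *\<^sub>R y) - s * q y = 0"
      using sublinear_scale[OF q, of s y] by simp
  qed auto
qed

text \<open>
  The Hahn-Banach theorem, by Zorn's lemma on the sublinear functionals below \<open>p\<close>. A minimal one,
  \<open>m\<close>, equals its own tilt along any \<open>y\<close>, hence \<open>m x \<le> m (x + y) - m y\<close>, and subadditivity gives
  the converse inequality.
\<close>
lemma sublinear_minorant_linear:
  fixes p :: "'a::real_vector \<Rightarrow> real"
  assumes p: "sublinear p"
  obtains f where "linear f" and "\<And>x. f x \<le> p x"
proof -
  define S where "S = {q. sublinear q \<and> q \<le> p}"
  have "\<exists>m\<in>S. \<forall>q\<in>S. q \<le> m \<longrightarrow> q = m"
  proof (rule predicate_Zorn)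
    show "partial_order_on S (relation_of (\<lambda>q r. r \<le> q) S)"
      by (rule partial_order_on_relation_ofI) auto
  next
    fix C assume chain: "C \<in> Chains (relation_of (\<lambda>q r. r \<le> q) S)"
    then have CS: "C \<subseteq> S" by (rule Chains_relation_of)
    have comparable: "q \<le> r \<or> r \<le> q" if "q \<in> C" "r \<in> C" for q r
      using chain that by (auto simp: Chains_def relation_of_def)
    show "\<exists>u\<in>S. \<forall>q\<in>C. u \<le> q"
    proof (cases "C = {}")
      case True
      then show ?thesis using p by (auto simp: S_def)
    next
      case False
      let ?u = "\<lambda>x. INF q\<in>C. q x"
      have bdd: "bdd_below ((\<lambda>q. q x) ` C)" for x
      proof (rule bdd_belowI2)
        fix q assume "q \<in> C"
        then have "sublinear q" "q (- x) \<le> p (- x)"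
          using CS by (auto simp: S_def le_fun_def)
        then show "- p (- x) \<le> q x"
          using sublinear_ge_minus[of q x] by simp
      qed
      have "sublinear ?u"
      proof (rule sublinear_INF[OF False bdd])
        fix q r x y assume qr: "q \<in> C" "r \<in> C"
        show "\<exists>k\<in>C. k (x + y) \<le> q x + r y"
          using comparable[OF qr]
        proof
          assume "q \<le> r"
          moreover have "q (x + y) \<le> q x + q y"
            using qr CS by (intro sublinear_add) (auto simp: S_def)
          ultimately show ?thesis
            using qr le_funD[of q r y] by (intro bexI[of _ q]) auto
        next
          assume "r \<le> q"
          moreover have "r (x + y) \<le> r x + r y"
            using qr CS by (intro sublinear_add) (auto simp: S_def)
          ultimately show ?thesis
            using qr le_funD[of r q x] by (intro bexI[of _ r]) auto
        qed
      next
        fix q x and t :: real assume "q \<in> C" "0 < t"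
        then show "\<exists>k\<in>C. k (t *\<^sub>R x) \<le> t * q x"
          using CS by (intro bexI[of _ q]) (auto simp: S_def sublinear_scale)
      next
        fix q assume "q \<in> C"
        then show "q 0 = 0" using CS by (auto simp: S_def sublinear_zero)
      qed
      moreover have lower: "?u x \<le> q x" if "q \<in> C" for q x
        using bdd that by (rule cINF_lower)
      moreover have "?u x \<le> p x" for x
      proof -
        obtain q where "q \<in> C" using False by blast
        then have "q x \<le> p x" using CS by (auto simp: S_def le_fun_def)
        then show ?thesis using lower[OF \<open>q \<in> C\<close>, of x] by simp
      qed
      ultimately show ?thesis
        by (intro bexI[of _ ?u]) (auto simp: S_def le_fun_def)
    qed
  qed
  then obtain m where m: "sublinear m" "m \<le> p"
    and minimal: "\<And>q. sublinear q \<Longrightarrow> q \<le> m \<Longrightarrow> q = m"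
    by (force simp: S_def intro: order_trans)
  have add: "m (x + y) = m x + m y" for x y
  proof -
    let ?r = "\<lambda>x. INF t\<in>{0..}. m (x + t *\<^sub>R y) - t * m y"
    have "?r z \<le> m z" for z
      using sublinear_tilt(2)[OF m(1), of 0 z y] by simp
    then have "?r = m"
      by (intro minimal sublinear_tilt(1) m) (simp add: le_fun_def)
    then have "m x \<le> m (x + y) - m y"
      using sublinear_tilt(2)[OF m(1), of 1 x y] by (simp add: fun_eq_iff)
    then show ?thesis using sublinear_add[OF m(1), of x y] by simp
  qed
  have "linear m"
  proof (rule linearI)
    fix c x
    show "m (c *\<^sub>R x) = c *\<^sub>R m x"
    proof (cases "0 \<le> c")
      case True
      then show ?thesis using m by (simp add: sublinear_scale)
    next
      case False
      have "m (c *\<^sub>R x) + m ((- c) *\<^sub>R x) = 0"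
        using add[of "c *\<^sub>R x" "(- c) *\<^sub>R x"] m(1) by (simp add: sublinear_zero)
      moreover have "m ((- c) *\<^sub>R x) = (- c) * m x"
        using m(1) False by (intro sublinear_scale) auto
      ultimately show ?thesis by simp
    qed
  qed (rule add)
  then show ?thesis using that m(2) by (auto simp: le_fun_def)
qed

lemma norming_functional:
  fixes x :: "'a::real_normed_vector"
  obtains f :: "'a \<Rightarrow>\<^sub>L real" where "\<And>y. \<bar>f y\<bar> \<le> norm y" and "f x = norm x"
proof -
  have norm: "sublinear (norm :: 'a \<Rightarrow> real)"
    by (simp add: sublinear_def norm_triangle_ineq)
  let ?r = "\<lambda>z. INF t\<in>{0..}. norm (z + t *\<^sub>R x) - t * norm x"
  obtain f where f: "linear f" and le: "\<And>z. f z \<le> ?r z"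
    using sublinear_minorant_linear[OF sublinear_tilt(1)[OF norm]] by blast
  have upper: "f z \<le> norm z" for z
    using le[of z] sublinear_tilt(2)[OF norm, of 0 z x] by simp
  have abs: "\<bar>f z\<bar> \<le> norm z" for z
    using upper[of z] upper[of "- z"] linear_neg[OF f, of z] by simp
  have "f (- x) \<le> - norm x"
    using le[of "- x"] sublinear_tilt(2)[OF norm, of 1 "- x" x] by simp
  then have "f x = norm x"
    using upper[of x] linear_neg[OF f, of x] by simp
  moreover have "bounded_linear f"
    by (intro bounded_linear_intro[where K = 1]) (auto simp: linear_add[OF f] linear_cmul[OF f] abs)
  ultimately show ?thesis
    using that[of "Blinfun f"] abs by (simp add: bounded_linear_Blinfun_apply)
qed

section \<open>The norm of a functional on a subspace\<close>

text \<open>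
  Only the restriction of a functional to the barrelled subspace \<open>L\<close> matters, and the norm of the
  restriction can be smaller than the norm on the whole space, since \<open>L\<close> need not be dense.
\<close>
definition norm_on :: "'a::real_normed_vector set \<Rightarrow> ('a \<Rightarrow>\<^sub>L real) \<Rightarrow> real"
  where "norm_on L f = (SUP x\<in>L \<inter> cball 0 1. \<bar>f x\<bar>)"

lemma bdd_above_norm_on:
  fixes f :: "'a::real_normed_vector \<Rightarrow>\<^sub>L real"
  shows "bdd_above ((\<lambda>x. \<bar>blinfun_apply f x\<bar>) ` (L \<inter> cball 0 1))"
proof (rule bdd_aboveI2)
  fix x :: 'a assume "x \<in> L \<inter> cball 0 1"
  then show "\<bar>f x\<bar> \<le> norm f"
    using norm_blinfun[of f x] mult_left_le[of "norm x" "norm f"] by simp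
qed

lemma norm_on_nonneg: "subspace L \<Longrightarrow> 0 \<le> norm_on L f"
  using cSUP_upper[OF _ bdd_above_norm_on, of 0 L f] by (simp add: norm_on_def subspace_0)

lemma abs_le_norm_on:
  assumes "subspace L" "x \<in> L"
  shows "\<bar>blinfun_apply f x\<bar> \<le> norm_on L f * norm x"
proof (cases "x = 0")
  case False
  have "x /\<^sub>R norm x \<in> L \<inter> cball 0 1"
    using assms False by (auto intro: subspace_scale)
  then have "\<bar>f (x /\<^sub>R norm x)\<bar> \<le> norm_on L f"
    unfolding norm_on_def by (rule cSUP_upper[OF _ bdd_above_norm_on])
  then show ?thesis
    using False by (simp add: blinfun.scaleR_right abs_mult field_simps)
qed simp

lemma norm_on_least:
  assumes "subspace L" "0 \<le> K" and "\<And>x. x \<in> L \<Longrightarrow> \<bar>blinfun_apply f x\<bar> \<le> K * norm x"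
  shows "norm_on L f \<le> K"
  unfolding norm_on_def
proof (rule cSUP_least)
  show "L \<inter> cball 0 1 \<noteq> {}"
    using subspace_0[OF \<open>subspace L\<close>] by force
  fix x assume "x \<in> L \<inter> cball 0 1"
  then show "\<bar>f x\<bar> \<le> K"
    using assms(3)[of x] mult_left_le[OF _ \<open>0 \<le> K\<close>, of "norm x"] by auto
qed

lemma norm_on_scaleR:
  assumes "subspace L" "0 < c"
  shows "norm_on L (c *\<^sub>R f) = c * norm_on L f"
proof -
  have le: "norm_on L (d *\<^sub>R h) \<le> d * norm_on L h" if "0 < d" for d h
  proof (rule norm_on_least)
    show "0 \<le> d * norm_on L h" using that norm_on_nonneg[OF \<open>subspace L\<close>] by simp
    show "\<bar>(d *\<^sub>R h) x\<bar> \<le> d * norm_on L h * norm x" if "x \<in> L" for x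
      using abs_le_norm_on[OF \<open>subspace L\<close> that, of h] \<open>0 < d\<close>
      by (simp add: blinfun.scaleR_left abs_mult)
  qed fact
  from le[of c f] le[of "inverse c" "c *\<^sub>R f"] \<open>0 < c\<close> show ?thesis
    by (simp add: field_simps)
qed

section \<open>A triangular system of functionals\<close>

lemma infinite_dim_kernel:
  fixes g :: "'a::real_normed_vector \<Rightarrow>\<^sub>L real"
  assumes "subspace V" and inf: "\<And>B. finite B \<Longrightarrow> \<not> V \<subseteq> span B" and "finite B"
  shows "\<not> V \<inter> {x. g x = 0} \<subseteq> span B"
proof
  assume B: "V \<inter> {x. g x = 0} \<subseteq> span B"
  show False
  proof (cases "\<exists>v\<in>V. g v \<noteq> 0")
    case True
    then obtain v where v: "v \<in> V" "g v \<noteq> 0" by blast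
    have "x \<in> span (insert v B)" if "x \<in> V" for x
    proof -
      have "x - (g x / g v) *\<^sub>R v \<in> V \<inter> {x. g x = 0}"
        using v that \<open>subspace V\<close>
        by (auto simp: blinfun.diff_right blinfun.scaleR_right intro: subspace_diff subspace_scale)
      then show ?thesis using B by (auto simp: span_breakdown_eq)
    qed
    then show False using inf[of "insert v B"] \<open>finite B\<close> by blast
  next
    case False
    then show False using inf[OF \<open>finite B\<close>] B by blast
  qed
qed

text \<open>
  A weak form of biorthogonality which can be obtained greedily and still gives a lower bound for
  the norm of \<open>\<Sum>i<n. c i *\<^sub>R g i\<close> on \<open>L\<close> in terms of the coefficients: evaluation at
  \<open>x (n - 1)\<close> isolates the last coefficient, then evaluation at \<open>x (n - 2)\<close> the one before it, and
  so on.
\<close>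
locale triangular_system =
  fixes L :: "'a::real_normed_vector set"
    and g :: "nat \<Rightarrow> 'a \<Rightarrow>\<^sub>L real"
    and x :: "nat \<Rightarrow> 'a"
  assumes subspace: "subspace L"
    and x_in: "x m \<in> L"
    and norm_x: "norm (x m) = 1"
    and g_le: "\<bar>g m y\<bar> \<le> norm y"
    and g_x: "g m (x m) = 1"
    and g_x_less: "i < m \<Longrightarrow> g i (x m) = 0"

text \<open>
  Finitely many functionals cut an infinite-dimensional space down to an infinite-dimensional one,
  so the common kernel of the functionals chosen so far always contains a unit vector of \<open>L\<close>; take
  a norming functional of it as the next one.
\<close>
lemma triangular_system_exists:
  fixes L :: "'a::real_normed_vector set"
  assumes L: "subspace L" and inf: "\<And>B. finite B \<Longrightarrow> \<not> L \<subseteq> span B"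
  obtains g x where "triangular_system L g x"
proof -
  define P where "P = (\<lambda>(f :: nat \<Rightarrow> ('a \<Rightarrow>\<^sub>L real) \<times> 'a) m (h, z).
    z \<in> L \<and> norm z = 1 \<and> (\<forall>y. \<bar>blinfun_apply h y\<bar> \<le> norm y) \<and> blinfun_apply h z = 1 \<and>
    (\<forall>i<m. blinfun_apply (fst (f i)) z = 0))"
  have "\<exists>f. \<forall>m. P f m (f m)"
  proof (rule dependent_wellorder_choice)
    fix f f' :: "nat \<Rightarrow> ('a \<Rightarrow>\<^sub>L real) \<times> 'a" and m r
    assume "\<And>y. y < m \<Longrightarrow> f y = f' y"
    then show "P f m r = P f' m r" by (auto simp: P_def)
  next
    fix f :: "nat \<Rightarrow> ('a \<Rightarrow>\<^sub>L real) \<times> 'a" and m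
    have "subspace (L \<inter> {z. \<forall>i<k. blinfun_apply (fst (f i)) z = 0}) \<and>
        (\<forall>B. finite B \<longrightarrow> \<not> L \<inter> {z. \<forall>i<k. blinfun_apply (fst (f i)) z = 0} \<subseteq> span B)" for k
    proof (induction k)
      case 0
      then show ?case using assms by simp
    next
      case (Suc k)
      have eq: "L \<inter> {z. \<forall>i<Suc k. blinfun_apply (fst (f i)) z = 0} =
          (L \<inter> {z. \<forall>i<k. blinfun_apply (fst (f i)) z = 0}) \<inter> {z. blinfun_apply (fst (f k)) z = 0}"
        by (auto simp: less_Suc_eq)
      have "subspace {z. blinfun_apply (fst (f k)) z = 0}"
        by (auto simp: subspace_def blinfun.add_right blinfun.scaleR_right)
      then show ?case
        unfolding eq using Suc infinite_dim_kernel by (auto intro!: subspace_inter)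
    qed
    from this[of m] have V: "subspace (L \<inter> {z. \<forall>i<m. blinfun_apply (fst (f i)) z = 0})"
      "\<not> L \<inter> {z. \<forall>i<m. blinfun_apply (fst (f i)) z = 0} \<subseteq> span {}"
      by blast+
    then obtain y where y: "y \<in> L \<inter> {z. \<forall>i<m. blinfun_apply (fst (f i)) z = 0}" "y \<noteq> 0"
      by auto
    define z where "z = y /\<^sub>R norm y"
    have z: "z \<in> L \<inter> {z. \<forall>i<m. blinfun_apply (fst (f i)) z = 0}" "norm z = 1"
      using subspace_scale[OF V(1) y(1)] y(2) by (auto simp: z_def)
    obtain h :: "'a \<Rightarrow>\<^sub>L real" where "\<And>y. \<bar>h y\<bar> \<le> norm y" "h z = norm z"
      using norming_functional by blast
    then show "\<exists>r. P f m r"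
      using z by (intro exI[of _ "(h, z)"]) (auto simp: P_def)
  qed
  then obtain f where f: "\<And>m. P f m (f m)" by blast
  have "triangular_system L (\<lambda>m. fst (f m)) (\<lambda>m. snd (f m))"
    using f \<open>subspace L\<close> by unfold_locales (auto simp: P_def split_beta)
  then show ?thesis using that by blast
qed

section \<open>Spread-out functionals\<close>

lemma gram_schmidt:
  fixes B :: "'v::real_vector \<Rightarrow> 'v \<Rightarrow> real" and v :: "nat \<Rightarrow> 'v"
  assumes lin: "\<And>h. linear (\<lambda>f. B f h)" and sym: "\<And>f h. B f h = B h f"
    and pos: "\<And>f. f \<in> span (v ` {..<n}) \<Longrightarrow> f \<noteq> 0 \<Longrightarrow> 0 < B f f"
    and indep: "\<And>m. m < n \<Longrightarrow> v m \<notin> span (v ` {..<m})"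
  shows "\<exists>u. (\<forall>i<n. u i \<in> span (v ` {..<n})) \<and> (\<forall>i<n. \<forall>j<n. B (u i) (u j) = of_bool (i = j))"
  using pos indep
proof (induction n)
  case (Suc n)
  let ?S = "\<lambda>n. span (v ` {..<n})"
  have mono: "?S n \<subseteq> ?S (Suc n)" by (intro span_mono) auto
  have "\<exists>u. (\<forall>i<n. u i \<in> ?S n) \<and> (\<forall>i<n. \<forall>j<n. B (u i) (u j) = of_bool (i = j))"
    by (rule Suc.IH) (use Suc.prems mono in auto)
  then obtain u where u: "\<And>i. i < n \<Longrightarrow> u i \<in> ?S n"
    and ortho: "\<And>i j. i < n \<Longrightarrow> j < n \<Longrightarrow> B (u i) (u j) = of_bool (i = j)"
    by blast
  define p where "p = (\<Sum>i<n. B (v n) (u i) *\<^sub>R u i)"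
  define h where "h = v n - p"
  have p: "p \<in> ?S n" unfolding p_def by (auto intro!: span_sum span_scale u)
  have h: "h \<in> ?S (Suc n)" unfolding h_def
    using p mono by (intro span_diff) (auto intro: span_base)
  have "h \<noteq> 0" using p Suc.prems(2)[of n] by (auto simp: h_def)
  with h have q: "0 < B h h" using Suc.prems(1) by blast
  have hu: "B h (u j) = 0" if "j < n" for j
  proof -
    have "B p (u j) = (\<Sum>i<n. B (v n) (u i) * of_bool (i = j))"
      unfolding p_def using that ortho
      by (simp add: linear_sum[OF lin] linear_cmul[OF lin])
    then show ?thesis using that by (simp add: h_def linear_diff[OF lin])
  qed
  define u' where "u' = u(n := h /\<^sub>R sqrt (B h h))"
  have scale: "B (c *\<^sub>R f) k = c * B f k" "B k (c *\<^sub>R f) = c * B k f" for c f k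
    using linear_cmul[OF lin, of c f k] by (simp_all add: sym[of k])
  have "u' i \<in> ?S (Suc n)" if "i < Suc n" for i
    using that u[of i] mono h by (cases "i = n") (auto simp: u'_def intro: span_scale)
  moreover have "B (u' i) (u' j) = of_bool (i = j)" if "i < Suc n" "j < Suc n" for i j
    using that q hu[of i] hu[of j] ortho[of i j] sym[of "u i" h]
    by (cases "i = n"; cases "j = n") (auto simp: u'_def scale field_simps)
  ultimately show ?case by blast
qed simp

context triangular_system
begin

abbreviation H :: "nat \<Rightarrow> ('a \<Rightarrow>\<^sub>L real) set"
  where "H n \<equiv> span (g ` {..<n})"

lemma vanishes:
  assumes "f \<in> H n" "n \<le> m"
  shows "f (x m) = 0"
  using assms(1)
proof (induction rule: span_induct)
  case base
  show ?case by (auto simp: subspace_def blinfun.add_left blinfun.scaleR_left)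
next
  case (step f)
  then show ?case using g_x_less assms(2) by auto
qed

lemma g_notin_span: "g m \<notin> H m"
proof
  assume "g m \<in> H m"
  then show False using vanishes[of "g m" m m] g_x[of m] by simp
qed

text \<open>
  On the functionals in \<open>H n\<close> of norm at most \<open>K\<close> on \<open>L\<close>, two points that \<open>g 0, \<dots>, g (n - 1)\<close>
  hardly distinguish are hardly distinguished at all, uniformly. This substitutes for the
  equivalence of norms on the finite-dimensional space \<open>H n\<close>. Splitting off the last coordinate at
  most doubles the bound \<open>K\<close> and costs one further \<open>K * \<eta>\<close>, whence the factor 3 per dimension.
\<close>
lemma span_evaluation_close:
  assumes "f \<in> H n" "\<And>y. y \<in> L \<Longrightarrow> \<bar>blinfun_apply f y\<bar> \<le> K * norm y" "0 \<le> \<eta>"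
    and close: "\<And>i. i < n \<Longrightarrow> \<bar>g i a - g i b\<bar> \<le> \<eta>"
  shows "\<bar>f a - f b\<bar> \<le> 3 ^ n * K * \<eta>"
  using assms(1,2) close
proof (induction n arbitrary: f K)
  case 0
  have "0 \<le> K" using 0(2)[OF x_in[of 0]] by (simp add: norm_x)
  then show ?case using 0 \<open>0 \<le> \<eta>\<close> by simp
next
  case (Suc n)
  obtain k where k: "f - k *\<^sub>R g n \<in> H n"
    using Suc.prems(1) by (auto simp: lessThan_Suc span_breakdown_eq)
  have "f (x n) = k"
    using vanishes[OF k, of n] by (simp add: blinfun.diff_left blinfun.scaleR_left g_x)
  then have kK: "\<bar>k\<bar> \<le> K" using Suc.prems(2)[OF x_in[of n]] by (simp add: norm_x)
  have "\<bar>(f - k *\<^sub>R g n) a - (f - k *\<^sub>R g n) b\<bar> \<le> 3 ^ n * (2 * K) * \<eta>"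
  proof (rule Suc.IH[OF k])
    fix y assume "y \<in> L"
    have "\<bar>k * g n y\<bar> \<le> K * norm y"
      unfolding abs_mult using kK g_le by (intro mult_mono) auto
    then show "\<bar>(f - k *\<^sub>R g n) y\<bar> \<le> 2 * K * norm y"
      using Suc.prems(2)[OF \<open>y \<in> L\<close>] by (simp add: blinfun.diff_left blinfun.scaleR_left)
  qed (use Suc.prems(3) in auto)
  moreover have "\<bar>k * (g n a - g n b)\<bar> \<le> K * \<eta>"
    unfolding abs_mult using kK Suc.prems(3)[of n] by (intro mult_mono) auto
  moreover have "K * \<eta> \<le> 3 ^ n * (K * \<eta>)"
    using kK \<open>0 \<le> \<eta>\<close> one_le_power[of "3::real" n] mult_right_mono[of 1 "3 ^ n" "K * \<eta>"] by simp
  ultimately show ?case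
    by (simp add: blinfun.diff_left blinfun.scaleR_left algebra_simps)
qed

text \<open>
  The previous lemma with \<open>K = 0\<close>: a functional in \<open>H n\<close> that vanishes on \<open>L\<close> takes the same value
  at any \<open>a\<close> and at \<open>0\<close>.
\<close>
lemma norm_on_pos:
  assumes "f \<in> H n" "f \<noteq> 0"
  shows "0 < norm_on L f"
proof (rule ccontr)
  assume "\<not> 0 < norm_on L f"
  then have le: "\<bar>f y\<bar> \<le> 0 * norm y" if "y \<in> L" for y
    using abs_le_norm_on[OF subspace that, of f] mult_nonpos_nonneg[of "norm_on L f" "norm y"] by simp
  have "f a = 0" for a
    using span_evaluation_close[OF assms(1) le, of "norm a" a 0] g_le by simp
  then show False using \<open>f \<noteq> 0\<close> by (simp add: blinfun_eqI)
qed

text \<open>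
  The heart of the argument. For points \<open>a\<close> of the unit ball of \<open>L\<close> with a probability weight \<open>w\<close>,
  let \<open>B\<close> be the inner product of evaluations in \<open>L\<^sup>2(w)\<close>. If no functional of norm 1 in \<open>H n\<close> were
  small in \<open>L\<^sup>2(w)\<close>, the norm of \<open>L\<^sup>2(w)\<close> would dominate \<open>sqrt \<epsilon>\<close> times the norm on \<open>L\<close>. For a
  \<open>B\<close>-orthonormal family \<open>u\<close> of length \<open>n\<close> this yields the Bessel-type bound
  \<open>(\<Sum>i<n. (u i a)\<^sup>2) \<le> 1 / \<epsilon>\<close> at each of the points. The weighted mean of the left-hand side is
  \<open>n\<close>, which exceeds \<open>1 / \<epsilon>\<close>.
\<close>
lemma exists_small_in_mean:
  fixes w :: "'a \<Rightarrow> real" and n :: nat and \<epsilon> :: real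
  assumes P: "finite P" "P \<subseteq> L \<inter> cball 0 1"
    and w: "\<And>a. a \<in> P \<Longrightarrow> 0 \<le> w a" "(\<Sum>a\<in>P. w a) = 1"
    and n: "1 < real n * \<epsilon>" "0 < \<epsilon>"
  shows "\<exists>f\<in>H n. norm_on L f = 1 \<and> (\<Sum>a\<in>P. w a * (blinfun_apply f a)\<^sup>2) \<le> \<epsilon>"
proof (rule ccontr)
  assume contra: "\<not> ?thesis"
  define B where "B = (\<lambda>f h. \<Sum>a\<in>P. w a * blinfun_apply f a * blinfun_apply h a)"
  have B_big: "\<epsilon> * (norm_on L f)\<^sup>2 < B f f" if f: "f \<in> H n" "f \<noteq> 0" for f
  proof -
    define p where "p = norm_on L f"
    have p: "0 < p" using norm_on_pos f by (simp add: p_def)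
    then have "norm_on L (f /\<^sub>R p) = 1"
      using norm_on_scaleR[OF subspace, of "inverse p" f] by (simp add: p_def)
    moreover have "f /\<^sub>R p \<in> H n" using f by (intro span_scale)
    ultimately have "\<epsilon> < (\<Sum>a\<in>P. w a * ((f /\<^sub>R p) a)\<^sup>2)" using contra by force
    also have "\<dots> = B f f / p\<^sup>2"
      by (simp add: B_def sum_divide_distrib blinfun.scaleR_left field_simps power2_eq_square)
    finally show ?thesis using p by (simp add: field_simps p_def)
  qed
  have lin: "linear (\<lambda>f. B f h)" for h
    by (rule linearI)
       (auto simp: B_def blinfun.add_left blinfun.scaleR_left algebra_simps sum.distrib sum_distrib_left)
  have sym: "B f h = B h f" for f h by (simp add: B_def mult_ac)
  have "0 < B f f" if "f \<in> H n" "f \<noteq> 0" for f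
    using B_big[OF that] \<open>0 < \<epsilon>\<close> by (smt (verit) mult_nonneg_nonneg zero_le_power2)
  then obtain u where u: "\<And>i. i < n \<Longrightarrow> u i \<in> H n"
    and ortho: "\<And>i j. i < n \<Longrightarrow> j < n \<Longrightarrow> B (u i) (u j) = of_bool (i = j)"
    using gram_schmidt[where B = B and n = n and v = g, OF lin sym] g_notin_span by metis
  have bessel: "(\<Sum>i<n. (u i a)\<^sup>2) * \<epsilon> \<le> 1" if "a \<in> P" for a
  proof -
    have a: "a \<in> L" "norm a \<le> 1" using that P by auto
    \<comment> \<open>The functional \<open>f\<close> represents evaluation at \<open>a\<close> on the span of \<open>u\<close> with respect to \<open>B\<close>,
      so its value at \<open>a\<close> is its squared \<open>B\<close>-norm; comparing with its norm on \<open>L\<close> bounds that.\<close>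
    define f where "f = (\<Sum>i<n. u i a *\<^sub>R u i)"
    define s where "s = (\<Sum>i<n. (u i a)\<^sup>2)"
    have "f \<in> H n" unfolding f_def by (intro span_sum span_scale u) auto
    have fa: "f a = s"
      by (simp add: f_def s_def blinfun.sum_left blinfun.scaleR_left power2_eq_square)
    have Bu: "B f (u j) = u j a" if "j < n" for j
      using that ortho by (simp add: f_def linear_sum[OF lin] linear_cmul[OF lin])
    have "B f h = (\<Sum>i<n. u i a * B (u i) h)" for h
      by (simp add: f_def linear_sum[OF lin] linear_cmul[OF lin])
    then have Bff: "B f f = s"
      using Bu sym[of _ f] by (simp add: s_def power2_eq_square)
    show ?thesis
    proof (cases "s = 0")
      case False
      have "0 \<le> s" by (simp add: s_def sum_nonneg)
      with False have "0 < s" by simp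
      then have "f \<noteq> 0" using fa by auto
      have "s \<le> norm_on L f * norm a"
        using abs_le_norm_on[OF subspace a(1), of f] fa \<open>0 < s\<close> by simp
      also have "\<dots> \<le> norm_on L f"
        using norm_on_pos[OF \<open>f \<in> H n\<close> \<open>f \<noteq> 0\<close>] a(2) by (simp add: mult_left_le)
      finally have "s\<^sup>2 \<le> (norm_on L f)\<^sup>2" using \<open>0 < s\<close> by (simp add: power_mono)
      then have "\<epsilon> * s\<^sup>2 \<le> \<epsilon> * (norm_on L f)\<^sup>2"
        using \<open>0 < \<epsilon>\<close> by simp
      also have "\<dots> < s" using B_big[OF \<open>f \<in> H n\<close> \<open>f \<noteq> 0\<close>] Bff by simp
      finally have "\<epsilon> * s * s < 1 * s" by (simp add: power2_eq_square)
      then have "\<epsilon> * s < 1" using \<open>0 < s\<close> by (simp only: mult_less_cancel_right_pos)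
      then show ?thesis using \<open>0 < s\<close> by (simp add: mult.commute flip: s_def)
    qed (simp add: s_def[symmetric])
  qed
  have "real n = (\<Sum>i<n. B (u i) (u i))" using ortho by simp
  also have "\<dots> = (\<Sum>a\<in>P. w a * (\<Sum>i<n. (u i a)\<^sup>2))"
    by (subst sum_distrib_left, subst sum.swap) (simp add: B_def power2_eq_square mult_ac)
  finally have "real n * \<epsilon> = (\<Sum>a\<in>P. w a * ((\<Sum>i<n. (u i a)\<^sup>2) * \<epsilon>))"
    by (simp only: sum_distrib_right mult.assoc)
  also have "\<dots> \<le> (\<Sum>a\<in>P. w a * 1)"
    using bessel w(1) by (intro sum_mono mult_left_mono)
  finally show False using n w(2) by simp
qed

text \<open>
  The previous lemma finds a functional that is small on average for any given weights; a minimax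
  argument turns this into a sequence of functionals that is small on average at every point. The
  multiplicative weights method makes it explicit: give the point \<open>a\<close> the weight
  \<open>exp (\<Sum>i<N. (f i a)\<^sup>2)\<close>, so that points with large values so far count more, and choose the
  next functional small in mean for these weights. As \<open>exp t \<le> 1 + 2 * t\<close> on the unit interval,
  each step multiplies the total weight by at most \<open>1 + 2 * \<epsilon>\<close>.
\<close>
lemma multiplicative_weights:
  fixes n N :: nat and \<epsilon> :: real
  assumes P: "finite P" "P \<subseteq> L \<inter> cball 0 1" "P \<noteq> {}" and n: "1 < real n * \<epsilon>" "0 < \<epsilon>"
  shows "\<exists>f. (\<forall>i<N. f i \<in> H n \<and> norm_on L (f i) = 1) \<and>
    (\<Sum>a\<in>P. exp (\<Sum>i<N. (blinfun_apply (f i) a)\<^sup>2)) \<le> real (card P) * exp (2 * \<epsilon> * real N)"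
proof (induction N)
  case (Suc N)
  then obtain f where f: "\<And>i. i < N \<Longrightarrow> f i \<in> H n \<and> norm_on L (f i) = 1"
    and potential: "(\<Sum>a\<in>P. exp (\<Sum>i<N. (blinfun_apply (f i) a)\<^sup>2)) \<le> real (card P) * exp (2 * \<epsilon> * real N)"
    by blast
  define W where "W = (\<lambda>a. exp (\<Sum>i<N. (blinfun_apply (f i) a)\<^sup>2))"
  define \<Phi> where "\<Phi> = (\<Sum>a\<in>P. W a)"
  have W: "0 < W a" for a by (simp add: W_def)
  have "0 < \<Phi>" unfolding \<Phi>_def using P W by (intro sum_pos) auto
  then obtain h where h: "h \<in> H n" "norm_on L h = 1"
    and mean: "(\<Sum>a\<in>P. W a / \<Phi> * (blinfun_apply h a)\<^sup>2) \<le> \<epsilon>"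
    using exists_small_in_mean[OF P(1,2) _ _ n, of "\<lambda>a. W a / \<Phi>"] W
    by (auto simp: sum_divide_distrib[symmetric] \<Phi>_def[symmetric] less_imp_le)
  define f' where "f' = f(N := h)"
  have "(\<Sum>a\<in>P. exp (\<Sum>i<Suc N. (f' i a)\<^sup>2)) = (\<Sum>a\<in>P. W a * exp ((h a)\<^sup>2))"
    by (simp add: f'_def W_def exp_add)
  also have "\<dots> \<le> (\<Sum>a\<in>P. W a * (1 + 2 * (h a)\<^sup>2))"
  proof (intro sum_mono mult_left_mono)
    fix a assume "a \<in> P"
    then have "\<bar>h a\<bar> \<le> 1"
      using abs_le_norm_on[OF subspace, of a h] h P by fastforce
    then have "(h a)\<^sup>2 \<le> 1" by (simp add: abs_square_le_1)
    then have "exp ((h a)\<^sup>2) \<le> 1 + (h a)\<^sup>2 + ((h a)\<^sup>2)\<^sup>2" by (intro exp_bound) auto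
    also have "((h a)\<^sup>2)\<^sup>2 \<le> (h a)\<^sup>2"
      using mult_left_le[OF \<open>(h a)\<^sup>2 \<le> 1\<close>, of "(h a)\<^sup>2"]
      by (simp add: power2_eq_square[of "(h a)\<^sup>2"] flip: power_mult)
    finally show "exp ((h a)\<^sup>2) \<le> 1 + 2 * (h a)\<^sup>2" by simp
  qed (use W in \<open>auto simp: less_imp_le\<close>)
  also have "\<dots> = \<Phi> * (1 + 2 * (\<Sum>a\<in>P. W a / \<Phi> * (h a)\<^sup>2))"
    using \<open>0 < \<Phi>\<close> by (simp add: \<Phi>_def[symmetric] algebra_simps sum.distrib sum_distrib_left)
  also have "\<dots> \<le> \<Phi> * exp (2 * \<epsilon>)"
  proof (rule mult_left_mono)
    show "1 + 2 * (\<Sum>a\<in>P. W a / \<Phi> * (h a)\<^sup>2) \<le> exp (2 * \<epsilon>)"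
      using mean exp_ge_add_one_self[of "2 * \<epsilon>"] by linarith
  qed (use \<open>0 < \<Phi>\<close> in simp)
  also have "\<dots> \<le> real (card P) * exp (2 * \<epsilon> * real N) * exp (2 * \<epsilon>)"
    using potential by (simp add: \<Phi>_def W_def)
  also have "\<dots> = real (card P) * exp (2 * \<epsilon> * real (Suc N))"
    by (simp add: exp_add[symmetric] algebra_simps)
  finally show ?case
    using f h by (intro exI[of _ f']) (auto simp: f'_def less_Suc_eq)
qed (simp)

end

text \<open>
  Pigeonhole on the cells of a grid of mesh \<open>\<eta>\<close>.
\<close>
lemma finite_net:
  fixes g :: "nat \<Rightarrow> 'a \<Rightarrow> real"
  assumes "\<And>i a. a \<in> S \<Longrightarrow> \<bar>g i a\<bar> \<le> C" and "0 < \<eta>"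
  obtains P where "finite P" "P \<subseteq> S" "\<And>a. a \<in> S \<Longrightarrow> \<exists>b\<in>P. \<forall>i<n. \<bar>g i a - g i b\<bar> \<le> \<eta>"
proof -
  define cell where "cell a = restrict (\<lambda>i. \<lfloor>g i a / \<eta>\<rfloor>) {..<n}" for a
  have "cell ` S \<subseteq> {..<n} \<rightarrow>\<^sub>E {\<lfloor>- C / \<eta>\<rfloor>..\<lfloor>C / \<eta>\<rfloor>}"
  proof (intro image_subsetI PiE_I)
    fix a i assume "a \<in> S" "i \<in> {..<n}"
    then show "cell a i \<in> {\<lfloor>- C / \<eta>\<rfloor>..\<lfloor>C / \<eta>\<rfloor>}"
      using assms(1)[of a i] \<open>0 < \<eta>\<close>
      by (auto simp: cell_def abs_le_iff field_simps intro!: floor_mono)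
  qed (auto simp: cell_def)
  then have "finite (cell ` S)" by (rule finite_subset) (auto intro: finite_PiE)
  then obtain P where P: "P \<subseteq> S" "finite P" "cell ` S = cell ` P"
    using finite_subset_image[of "cell ` S" cell S] by auto
  have "\<exists>b\<in>P. \<forall>i<n. \<bar>g i a - g i b\<bar> \<le> \<eta>" if "a \<in> S" for a
  proof -
    have "cell a \<in> cell ` P" using that P(3) by blast
    then obtain b where b: "b \<in> P" "cell a = cell b" by blast
    have "\<bar>g i a - g i b\<bar> \<le> \<eta>" if "i < n" for i
    proof -
      have "\<lfloor>g i a / \<eta>\<rfloor> = \<lfloor>g i b / \<eta>\<rfloor>"
        using fun_cong[OF b(2), of i] that by (simp add: cell_def)
      then have "\<bar>g i a / \<eta> - g i b / \<eta>\<bar> \<le> 1" by linarith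
      then show ?thesis
        using \<open>0 < \<eta>\<close> by (simp add: diff_divide_distrib[symmetric] field_simps)
    qed
    then show ?thesis using b by blast
  qed
  with P that show ?thesis by blast
qed

text \<open>
  The multiplicative weights method is run on a net of the unit ball of \<open>L\<close> that is fine enough
  for all functionals of norm 1 in \<open>H n\<close>. The bound on the total weight gives
  \<open>(\<Sum>i<N. (f i b)\<^sup>2) \<le> ln (card P) + 2 * \<delta> * N\<close> at the points \<open>b\<close> of the net \<open>P\<close>, and for long
  sequences the logarithm is negligible.
\<close>
lemma spread_functionals:
  fixes L :: "'a::real_normed_vector set" and \<epsilon> :: real
  assumes L: "subspace L" and inf: "\<And>B. finite B \<Longrightarrow> \<not> L \<subseteq> span B" and "0 < \<epsilon>"
  obtains N :: nat and f :: "nat \<Rightarrow> 'a \<Rightarrow>\<^sub>L real"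
  where "0 < N" and "\<And>i. i < N \<Longrightarrow> norm_on L (f i) = 1"
    and "\<And>a. a \<in> L \<Longrightarrow> (\<Sum>i<N. (blinfun_apply (f i) a)\<^sup>2) \<le> \<epsilon> * real N * (norm a)\<^sup>2"
proof -
  obtain g x where "triangular_system L g x" using triangular_system_exists L inf by blast
  then interpret triangular_system L g x .
  \<comment> \<open>On the net the mean square is at most \<open>3 * \<delta>\<close>; passing to an arbitrary point doubles it and
    adds \<open>2 * \<delta>\<close>.\<close>
  define \<delta> where "\<delta> = \<epsilon> / 8"
  have \<delta>: "0 < \<delta>" using \<open>0 < \<epsilon>\<close> by (simp add: \<delta>_def)
  obtain n :: nat where n: "1 < n * \<delta>"
    using reals_Archimedean3[OF \<delta>] by blast
  have "\<bar>g i a\<bar> \<le> 1" if "a \<in> L \<inter> cball 0 1" for i a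
    using g_le[of i a] that by auto
  moreover define \<eta> where "\<eta> = sqrt \<delta> / 3 ^ n"
  moreover have \<eta>: "0 < \<eta>" using \<delta> by (simp add: \<eta>_def)
  ultimately obtain P where P: "finite P" "P \<subseteq> L \<inter> cball 0 1"
    and net: "\<And>a. a \<in> L \<inter> cball 0 1 \<Longrightarrow> \<exists>b\<in>P. \<forall>i<n. \<bar>g i a - g i b\<bar> \<le> \<eta>"
    using finite_net[of "L \<inter> cball 0 1" "\<lambda>i. blinfun_apply (g i)" 1 \<eta> n] by metis
  have "P \<noteq> {}" using net[of 0] subspace_0[OF L] by auto
  then have "0 < card P" using P by (simp add: card_gt_0_iff)
  obtain M :: nat where M: "ln (card P) < M * \<delta>"
    using reals_Archimedean3[OF \<delta>] by blast
  define N where "N = Suc M"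
  have N: "ln (card P) \<le> \<delta> * real N" "0 < N" using M \<delta> by (auto simp: N_def algebra_simps)
  obtain f where f: "\<And>i. i < N \<Longrightarrow> f i \<in> H n \<and> norm_on L (f i) = 1"
    and potential: "(\<Sum>a\<in>P. exp (\<Sum>i<N. (blinfun_apply (f i) a)\<^sup>2)) \<le> real (card P) * exp (2 * \<delta> * real N)"
    using multiplicative_weights[OF P \<open>P \<noteq> {}\<close> n \<delta>] by blast
  have on_net: "(\<Sum>i<N. (f i b)\<^sup>2) \<le> 3 * \<delta> * real N" if "b \<in> P" for b
  proof -
    have "exp (\<Sum>i<N. (f i b)\<^sup>2) \<le> real (card P) * exp (2 * \<delta> * real N)"
      by (rule order_trans[OF member_le_sum[OF that, of "\<lambda>b. exp (\<Sum>i<N. (f i b)\<^sup>2)"] potential])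
         (use P in auto)
    also have "\<dots> = exp (ln (card P) + 2 * \<delta> * real N)"
      using \<open>0 < card P\<close> by (simp add: exp_add)
    finally show ?thesis using N by simp
  qed
  have unit: "(\<Sum>i<N. (f i a)\<^sup>2) \<le> \<epsilon> * real N" if a: "a \<in> L \<inter> cball 0 1" for a
  proof -
    obtain b where b: "b \<in> P" "\<And>i. i < n \<Longrightarrow> \<bar>g i a - g i b\<bar> \<le> \<eta>"
      using net[OF a] by blast
    have "(\<Sum>i<N. (f i a)\<^sup>2) \<le> (\<Sum>i<N. 2 * (f i b)\<^sup>2 + 2 * \<delta>)"
    proof (rule sum_mono)
      fix i assume "i \<in> {..<N}"
      then have fi: "f i \<in> H n" "norm_on L (f i) = 1" using f by auto
      then have "\<bar>f i y\<bar> \<le> 1 * norm y" if "y \<in> L" for y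
        using abs_le_norm_on[OF L that, of "f i"] by simp
      then have "\<bar>f i a - f i b\<bar> \<le> 3 ^ n * 1 * \<eta>"
        using \<eta> b(2) by (intro span_evaluation_close[OF fi(1)]) auto
      also have "\<dots> = sqrt \<delta>" by (simp add: \<eta>_def)
      finally have "\<bar>f i a - f i b\<bar>\<^sup>2 \<le> (sqrt \<delta>)\<^sup>2" by (intro power_mono) auto
      then have "(f i a - f i b)\<^sup>2 \<le> \<delta>" using \<delta> by simp
      moreover have "(f i a)\<^sup>2 \<le> 2 * (f i b)\<^sup>2 + 2 * (f i a - f i b)\<^sup>2"
        using zero_le_power2[of "f i a - 2 * f i b"] by (simp add: power2_eq_square algebra_simps)
      ultimately show "(f i a)\<^sup>2 \<le> 2 * (f i b)\<^sup>2 + 2 * \<delta>" by simp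
    qed
    also have "\<dots> = 2 * (\<Sum>i<N. (f i b)\<^sup>2) + 2 * \<delta> * real N"
      by (simp add: sum.distrib sum_distrib_left)
    also have "\<dots> \<le> 8 * \<delta> * real N" using on_net[OF b(1)] by simp
    finally show ?thesis by (simp add: \<delta>_def)
  qed
  have "(\<Sum>i<N. (f i a)\<^sup>2) \<le> \<epsilon> * real N * (norm a)\<^sup>2" if "a \<in> L" for a
  proof (cases "a = 0")
    case False
    have "(\<Sum>i<N. (f i (a /\<^sub>R norm a))\<^sup>2) \<le> \<epsilon> * real N"
      using False that subspace_scale[OF L] by (intro unit) auto
    moreover have "(\<Sum>i<N. (f i (a /\<^sub>R norm a))\<^sup>2) = (\<Sum>i<N. (f i a)\<^sup>2) / (norm a)\<^sup>2"
      by (simp add: blinfun.scaleR_right sum_divide_distrib power_mult_distrib field_simps)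
    ultimately show ?thesis
      using False by (simp only: divide_le_eq zero_less_power2 norm_eq_zero) simp
  qed simp
  with that N(2) f show ?thesis by blast
qed

text \<open>
  Chebyshev's inequality for the uniform distribution on the index set; a mean square of
  \<open>\<epsilon> ^ 3 * (norm a)\<^sup>2\<close> leaves at most a fraction \<open>\<epsilon>\<close> of the values above \<open>\<epsilon> * norm a\<close>.
\<close>
lemma few_large_functionals:
  fixes L :: "'a::real_normed_vector set" and \<epsilon> :: real
  assumes L: "subspace L" and inf: "\<And>B. finite B \<Longrightarrow> \<not> L \<subseteq> span B" and "0 < \<epsilon>"
  obtains N :: nat and f :: "nat \<Rightarrow> 'a \<Rightarrow>\<^sub>L real"
  where "0 < N" and "\<And>i. i < N \<Longrightarrow> norm_on L (f i) = 1"
    and "\<And>a. a \<in> L \<Longrightarrow> card {i. i < N \<and> \<epsilon> * norm a < \<bar>blinfun_apply (f i) a\<bar>} \<le> \<epsilon> * real N"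
proof -
  obtain N :: nat and f :: "nat \<Rightarrow> 'a \<Rightarrow>\<^sub>L real"
    where N: "0 < N" and f: "\<And>i. i < N \<Longrightarrow> norm_on L (f i) = 1"
      and sq: "\<And>a. a \<in> L \<Longrightarrow> (\<Sum>i<N. (blinfun_apply (f i) a)\<^sup>2) \<le> \<epsilon> ^ 3 * real N * (norm a)\<^sup>2"
    using spread_functionals[OF L inf zero_less_power[OF \<open>0 < \<epsilon>\<close>]] by blast
  have "real (card {i. i < N \<and> \<epsilon> * norm a < \<bar>blinfun_apply (f i) a\<bar>}) \<le> \<epsilon> * real N" if "a \<in> L" for a
  proof (cases "a = 0")
    case True
    then show ?thesis using \<open>0 < \<epsilon>\<close> by simp
  next
    case False
    let ?I = "{i. i < N \<and> \<epsilon> * norm a < \<bar>blinfun_apply (f i) a\<bar>}"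
    have "real (card ?I) * (\<epsilon> * norm a)\<^sup>2 = (\<Sum>i\<in>?I. (\<epsilon> * norm a)\<^sup>2)" by simp
    also have "\<dots> \<le> (\<Sum>i\<in>?I. (f i a)\<^sup>2)"
    proof (rule sum_mono)
      fix i assume "i \<in> ?I"
      then have "(\<epsilon> * norm a)\<^sup>2 \<le> \<bar>f i a\<bar>\<^sup>2" using \<open>0 < \<epsilon>\<close> by (intro power_mono) auto
      then show "(\<epsilon> * norm a)\<^sup>2 \<le> (f i a)\<^sup>2" by simp
    qed
    also have "\<dots> \<le> (\<Sum>i<N. (f i a)\<^sup>2)" by (intro sum_mono2) auto
    also have "\<dots> \<le> \<epsilon> * real N * (\<epsilon> * norm a)\<^sup>2"
      using sq[OF that] by (simp add: power2_eq_square power3_eq_cube algebra_simps)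
    finally show ?thesis using False \<open>0 < \<epsilon>\<close> by simp
  qed
  with that N f show ?thesis by blast
qed

section \<open>Uniform boundedness on barrelled subspaces\<close>

context normed_vector_space
begin

lemma subspace_real: "subspace S \<Longrightarrow> real_vector.subspace S"
  unfolding real_vector.subspace_def subspace_def by (metis scale_of_real)

lemma span_real_subset: "real_vector.span B \<subseteq> span B"
  by (rule real_vector.span_minimal) (auto intro: subspace_real span_base)

lemma scale_scaleR: "smul c (r *\<^sub>R x) = r *\<^sub>R smul c x" "smul (r *\<^sub>R c) x = r *\<^sub>R smul c x"
  by (simp_all add: scale_of_real[symmetric] scaleR_conv_of_real mult.commute)

lemma bounded_linear_scale_right: "bounded_linear (smul c)"
  by (rule bounded_linear_intro[where K = "norm c"])
     (simp_all add: scale_right_distrib scale_scaleR norm_scale mult.commute)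

lemma bounded_linear_scale_left: "bounded_linear (\<lambda>c. smul c x)"
  by (rule bounded_linear_intro[where K = "norm x"])
     (simp_all add: scale_left_distrib scale_scaleR norm_scale)

text \<open>
  The Banach-Steinhaus theorem, where barrelledness replaces completeness. The functionals are only
  real-linear while barrels are absolutely convex over the scalar field, so the barrel consists of
  the points whose multiples by all scalars of norm at most 1 are mapped to numbers of modulus at most 1.
  Pointwise boundedness is asked for on the multiples of \<open>A\<close> by a real basis of the scalar field,
  that is, by \<open>1\<close>, or by \<open>1\<close> and \<open>\<i>\<close>.
\<close>
lemma barrelled_uniform_boundedness:
  fixes A :: "'a set" and \<phi> :: "'i \<Rightarrow> 'a \<Rightarrow>\<^sub>L real"
  assumes barrelled: "barrelled smul (top_of_set (span A))"
    and bdd: "\<And>a b. a \<in> A \<Longrightarrow> b \<in> Basis \<Longrightarrow> \<exists>C. \<forall>k. \<bar>blinfun_apply (\<phi> k) (smul b a)\<bar> \<le> C"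
  shows "\<exists>K. \<forall>k. norm_on (span A) (\<phi> k) \<le> K"
proof -
  define L where "L = span A"
  have L: "subspace L" by (simp add: L_def)
  define G where "G = {x. \<exists>S. \<forall>k c. \<bar>blinfun_apply (\<phi> k) (smul c x)\<bar> \<le> S * norm c}"
  have "L \<subseteq> G" unfolding L_def
  proof (rule span_minimal)
    show "subspace G"
    proof (rule subspaceI)
      show "0 \<in> G" by (auto simp: G_def intro: exI[of _ 0])
    next
      fix x y assume "x \<in> G" "y \<in> G"
      then obtain S T where "\<And>k c. \<bar>\<phi> k (smul c x)\<bar> \<le> S * norm c"
        "\<And>k c. \<bar>\<phi> k (smul c y)\<bar> \<le> T * norm c"
        by (auto simp: G_def)
      then have "\<bar>\<phi> k (smul c (x + y))\<bar> \<le> (S + T) * norm c" for k c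
        by (simp add: scale_right_distrib blinfun.add_right distrib_right)
           (meson abs_triangle_ineq add_mono order_trans)
      then show "x + y \<in> G" by (auto simp: G_def)
    next
      fix d x assume "x \<in> G"
      then obtain S where "\<And>k c. \<bar>\<phi> k (smul c x)\<bar> \<le> S * norm c"
        by (auto simp: G_def)
      then have "\<bar>\<phi> k (smul c (smul d x))\<bar> \<le> S * norm d * norm c" for k c
        by (metis norm_mult mult.assoc mult.commute scale_scale)
      then show "smul d x \<in> G" by (auto simp: G_def)
    qed
    show "A \<subseteq> G"
    proof
      fix a assume "a \<in> A"
      then obtain C where C: "\<And>b k. b \<in> Basis \<Longrightarrow> \<bar>\<phi> k (smul b a)\<bar> \<le> C b"
        using bdd by metis
      have "\<bar>\<phi> k (smul c a)\<bar> \<le> (\<Sum>b\<in>Basis. C b) * norm c" for k c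
      proof -
        have "smul c a = (\<Sum>b\<in>Basis. (c \<bullet> b) *\<^sub>R smul b a)"
          by (subst (1) euclidean_representation[of c, symmetric])
             (simp add: bounded_linear.linear[OF bounded_linear_scale_left, THEN linear_sum] scale_scaleR)
        then have "\<bar>\<phi> k (smul c a)\<bar> \<le> (\<Sum>b\<in>Basis. \<bar>(c \<bullet> b) * \<phi> k (smul b a)\<bar>)"
          by (simp add: blinfun.sum_right blinfun.scaleR_right sum_abs)
        also have "\<dots> \<le> (\<Sum>b\<in>Basis. norm c * C b)"
          unfolding abs_mult by (intro sum_mono mult_mono C Basis_le_norm) auto
        finally show ?thesis by (simp add: sum_distrib_left mult.commute)
      qed
      then show "a \<in> G" by (auto simp: G_def)
    qed
  qed
  define B where "B = {x \<in> L. \<forall>k c. norm c \<le> 1 \<longrightarrow> \<bar>blinfun_apply (\<phi> k) (smul c x)\<bar> \<le> 1}"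
  have B_le: "\<bar>\<phi> k (smul c x)\<bar> \<le> norm c" if "x \<in> B" for k c x
  proof (cases "c = 0")
    case False
    have "norm (c /\<^sub>R norm c) \<le> 1" using False by simp
    then have "\<bar>\<phi> k (smul (c /\<^sub>R norm c) x)\<bar> \<le> 1"
      using that unfolding B_def by blast
    then show ?thesis
      using False by (simp add: scale_scaleR blinfun.scaleR_right abs_mult field_simps)
  qed simp
  have "barrel smul (top_of_set L) B"
    unfolding barrel_def
  proof (intro conjI)
    have "closed {x. \<bar>\<phi> k (smul c x)\<bar> \<le> 1}" for k c
      by (intro closed_Collect_le continuous_intros
          bounded_linear.continuous_on[OF bounded_linear_scale_right])
    then have "closed (\<Inter>k. \<Inter>c\<in>cball 0 1. {x. \<bar>\<phi> k (smul c x)\<bar> \<le> 1})"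
      by (intro closed_INT ballI) auto
    moreover have "B = L \<inter> (\<Inter>k. \<Inter>c\<in>cball 0 1. {x. \<bar>\<phi> k (smul c x)\<bar> \<le> 1})"
      by (auto simp: B_def)
    ultimately show "closedin (top_of_set L) B"
      by (auto simp: closedin_closed)
  next
    show "absolutely_convex smul B"
      unfolding absolutely_convex_def
    proof (intro ballI allI impI)
      fix x y and a b :: 'k assume xy: "x \<in> B" "y \<in> B" and ab: "norm a + norm b \<le> 1"
      have "\<bar>\<phi> k (smul c (smul a x + smul b y))\<bar> \<le> 1" if "norm c \<le> 1" for k c
      proof -
        have "\<bar>\<phi> k (smul c (smul a x + smul b y))\<bar> \<le> norm (c * a) + norm (c * b)"
          using B_le[OF xy(1), of k "c * a"] B_le[OF xy(2), of k "c * b"]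
          by (simp add: scale_right_distrib blinfun.add_right)
        also have "\<dots> = norm c * (norm a + norm b)" by (simp add: norm_mult distrib_left)
        also have "\<dots> \<le> 1" using ab that by (intro mult_le_one) auto
        finally show ?thesis .
      qed
      moreover have "smul a x + smul b y \<in> L"
        using xy L by (auto simp: B_def intro: subspace_add subspace_scale)
      ultimately show "smul a x + smul b y \<in> B" by (simp add: B_def)
    qed
  next
    show "absorbing_in smul (topspace (top_of_set L)) B"
      unfolding absorbing_in_def
    proof
      fix x assume "x \<in> topspace (top_of_set L)"
      then have x: "x \<in> L" by simp
      then have "x \<in> G" using \<open>L \<subseteq> G\<close> by blast
      then obtain S where S: "\<And>k c. \<bar>\<phi> k (smul c x)\<bar> \<le> S * norm c"
        by (auto simp: G_def)
      define r where "r = 1 / (1 + \<bar>S\<bar>)"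
      have "smul d x \<in> B" if d: "norm d \<le> r" for d
      proof -
        have "\<bar>\<phi> k (smul c (smul d x))\<bar> \<le> 1" if "norm c \<le> 1" for k c
        proof -
          have "\<bar>\<phi> k (smul c (smul d x))\<bar> \<le> S * (norm c * norm d)"
            using S[of k "c * d"] by (simp add: norm_mult)
          also have "\<dots> \<le> (1 + \<bar>S\<bar>) * (1 * r)"
            using d that by (intro mult_mono) auto
          also have "\<dots> = 1" by (simp add: r_def)
          finally show ?thesis .
        qed
        then show ?thesis using x L by (simp add: B_def subspace_scale)
      qed
      moreover have "0 < r" by (simp add: r_def)
      ultimately show "\<exists>r>0. \<forall>c. norm c \<le> r \<longrightarrow> smul c x \<in> B" by blast
    qed
  qed
  then obtain U where U: "openin (top_of_set L) U" "0 \<in> U" "U \<subseteq> B"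
    using barrelled unfolding barrelled_def L_def by blast
  then obtain r where r: "0 < r" "ball 0 r \<inter> L \<subseteq> U"
    by (auto simp: openin_contains_ball)
  have "norm_on L (\<phi> k) \<le> 2 / r" for k
  proof (rule norm_on_least)
    show "real_vector.subspace L" using L by (rule subspace_real)
    show "0 \<le> 2 / r" using r by simp
    fix x assume x: "x \<in> L"
    show "\<bar>\<phi> k x\<bar> \<le> 2 / r * norm x"
    proof (cases "x = 0")
      case False
      define t where "t = r / (2 * norm x)"
      have t: "0 < t" using False r by (simp add: t_def)
      have "t *\<^sub>R x \<in> ball 0 r \<inter> L"
        using False r x \<open>real_vector.subspace L\<close>
        by (auto simp: t_def intro: real_vector.subspace_scale)
      then have "t *\<^sub>R x \<in> B" using r U by blast
      then have "\<bar>\<phi> k (smul 1 (t *\<^sub>R x))\<bar> \<le> 1"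
        using B_le[of "t *\<^sub>R x" k 1] by simp
      then have "t * \<bar>\<phi> k x\<bar> \<le> 1" using t by (simp add: blinfun.scaleR_right abs_mult)
      then show ?thesis using False r by (simp add: t_def field_simps)
    qed simp
  qed
  then show ?thesis unfolding L_def by blast
qed

end

section \<open>Random choices\<close>

text \<open>
  The index \<open>nat \<lfloor>N k * \<omega>\<rfloor>\<close> is uniformly distributed on \<open>{..<N k}\<close> when \<open>\<omega>\<close> is uniformly
  distributed on \<open>{0..<1}\<close>. The choices for different \<open>k\<close> that a single number \<open>\<omega>\<close> makes in this
  way are dependent, but the convergence half of the Borel-Cantelli lemma holds for arbitrary
  events.
\<close>
lemma recurrent_rare_cells_null:
  fixes N :: "nat \<Rightarrow> nat" and I :: "nat \<Rightarrow> nat set"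
  assumes N: "\<And>k. 0 < N k" and I: "\<And>k. I k \<subseteq> {..<N k}"
    and small: "\<And>k. real (card (I k)) \<le> (1 / 2) ^ k * real (N k)"
  shows "{\<omega> \<in> {0..<1}. \<exists>\<^sub>\<infinity>k. nat \<lfloor>real (N k) * \<omega>\<rfloor> \<in> I k} \<in> null_sets lebesgue"
proof -
  define J :: "nat \<Rightarrow> nat \<Rightarrow> real set"
    where "J = (\<lambda>k i. {real i / real (N k) ..< (real i + 1) / real (N k)})"
  define E where "E = (\<lambda>k. \<Union>i\<in>I k. J k i)"
  have fin: "finite (I k)" for k using I[of k] finite_subset by blast
  have J: "J k i \<in> sets lebesgue" for k i by (simp add: J_def)
  have measure_J: "measure lebesgue (J k i) = 1 / real (N k)" for k i
    using N[of k] by (simp add: J_def divide_right_mono diff_divide_distrib[symmetric])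
  have "limsup E \<in> null_sets lebesgue"
  proof (rule borel_cantelli_limsup1)
    show "E k \<in> sets lebesgue" for k
      unfolding E_def using J fin by auto
    have "E k \<in> lmeasurable" for k
      unfolding E_def using fin J
      by (intro fmeasurable.finite_UN bounded_set_imp_lmeasurable) (auto simp: J_def)
    then show "emeasure lebesgue (E k) < \<infinity>" for k
      unfolding infinity_ennreal_def less_top[symmetric] by (rule fmeasurableD2)
    show "summable (\<lambda>k. measure lebesgue (E k))"
    proof (rule summable_comparison_test'[where g = "\<lambda>k. (1 / 2) ^ k" and N = 0])
      fix k
      have "measure lebesgue (E k) \<le> (\<Sum>i\<in>I k. measure lebesgue (J k i))"
        unfolding E_def by (intro measure_UNION_le fin J)
      also have "\<dots> = real (card (I k)) / real (N k)" by (simp add: measure_J)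
      also have "\<dots> \<le> (1 / 2) ^ k" using small[of k] N[of k] by (simp add: field_simps)
      finally show "norm (measure lebesgue (E k)) \<le> (1 / 2) ^ k" by simp
    qed (simp add: summable_geometric)
  qed
  moreover have "{\<omega> \<in> {0..<1}. \<exists>\<^sub>\<infinity>k. nat \<lfloor>real (N k) * \<omega>\<rfloor> \<in> I k} \<subseteq> limsup E"
  proof safe
    fix \<omega> :: real assume \<omega>: "\<omega> \<in> {0..<1}" and inf: "\<exists>\<^sub>\<infinity>k. nat \<lfloor>real (N k) * \<omega>\<rfloor> \<in> I k"
    have "\<omega> \<in> E k" if "nat \<lfloor>real (N k) * \<omega>\<rfloor> \<in> I k" for k
    proof -
      let ?i = "nat \<lfloor>real (N k) * \<omega>\<rfloor>"
      have "real ?i \<le> real (N k) * \<omega>" "real (N k) * \<omega> < real ?i + 1"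
        using \<omega> by (simp_all add: of_nat_nat)
      then have "\<omega> \<in> J k ?i" using N[of k] by (simp add: J_def field_simps)
      then show ?thesis using that by (auto simp: E_def)
    qed
    then have "\<exists>\<^sub>\<infinity>k. \<omega> \<in> E k" using inf by (rule INFM_mono[rotated])
    then show "\<omega> \<in> limsup E"
      by (force simp: limsup_INF_SUP INFM_nat_le)
  qed
  ultimately show ?thesis
    by (rule null_sets_completion_subset[rotated])
qed

section \<open>Generating sets of barrelled subspaces\<close>

theorem theorem0p3:
  fixes smul :: "'k::{real_normed_field, euclidean_space} \<Rightarrow> 'a::banach \<Rightarrow> 'a"
    and A :: "'a set"
  assumes "normed_vector_space smul"
    and "infinite_dimensional smul (UNIV :: 'a set)"
    and "infinite_dimensional smul (module.span smul A)"
    and "barrelled smul (top_of_set (module.span smul A))"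
  shows "cov_null \<le>o |A|"
proof -
  interpret V: normed_vector_space smul by fact
  define L where "L = V.span A"
  have L: "subspace L" unfolding L_def by (intro V.subspace_real V.subspace_span)
  have inf: "\<not> L \<subseteq> span B" if "finite B" for B
    using assms(3) that V.span_real_subset[of B]
    unfolding infinite_dimensional_def L_def by blast
  define Q where "Q = (\<lambda>k (N :: nat) f. 0 < N \<and> (\<forall>i<N. norm_on L (f i) = 1) \<and>
    (\<forall>a\<in>L. real (card {i. i < N \<and> (1 / 2) ^ k * norm a < \<bar>blinfun_apply (f i) a\<bar>})
      \<le> (1 / 2) ^ k * real N))"
  have "\<exists>N f. Q k N f" for k
    unfolding Q_def
    by (rule few_large_functionals[OF L inf, of "(1 / 2) ^ k"]) (simp, simp, blast)
  then obtain N f where Q: "\<And>k. Q k (N k) (f k)" by metis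
  have N: "\<And>k. 0 < N k" and f: "\<And>k i. i < N k \<Longrightarrow> norm_on L (f k i) = 1"
    and few: "\<And>k a. a \<in> L \<Longrightarrow>
      real (card {i. i < N k \<and> (1 / 2) ^ k * norm a < \<bar>blinfun_apply (f k i) a\<bar>})
        \<le> (1 / 2) ^ k * real (N k)"
    using Q by (simp_all add: Q_def)
  define ix where "ix = (\<lambda>k \<omega>. nat \<lfloor>real (N k) * \<omega>\<rfloor>)"
  have ix: "ix k \<omega> < N k" if "\<omega> \<in> {0..<1}" for k \<omega>
    using that N[of k] by (simp add: ix_def nat_less_iff floor_less_iff)
  define bad where "bad = (\<lambda>a. {\<omega> \<in> {0..<1}. \<exists>\<^sub>\<infinity>k. (1 / 2) ^ k * norm a < \<bar>blinfun_apply (f k (ix k \<omega>)) a\<bar>})"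
  have bad: "bad a \<in> null_sets lebesgue" if "a \<in> L" for a
  proof -
    have "bad a = {\<omega> \<in> {0..<1}. \<exists>\<^sub>\<infinity>k. nat \<lfloor>real (N k) * \<omega>\<rfloor>
        \<in> {i. i < N k \<and> (1 / 2) ^ k * norm a < \<bar>blinfun_apply (f k i) a\<bar>}}"
      unfolding bad_def using ix by (intro Collect_cong) (auto simp: ix_def)
    also have "\<dots> \<in> null_sets lebesgue"
      by (rule recurrent_rare_cells_null) (use N few that in auto)
    finally show ?thesis .
  qed
  \<comment> \<open>At \<open>\<omega> = 1\<close> the index \<open>ix k \<omega> = N k\<close> is out of range.\<close>
  define Z where "Z = (\<lambda>a. insert 1 (\<Union>b\<in>Basis. bad (smul b a)))"
  have Z: "Z a \<in> null_sets lebesgue" if "a \<in> A" for a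
  proof -
    have "smul b a \<in> L" for b
      unfolding L_def using that by (intro V.span_scale V.span_base)
    then have "(\<Union>b\<in>Basis. bad (smul b a)) \<in> null_sets lebesgue"
      using bad by (intro null_sets.finite_UN) auto
    moreover have "{1 :: real} \<in> null_sets lebesgue"
      by (intro null_sets_completionI) (simp add: null_sets_def)
    ultimately show ?thesis
      unfolding Z_def by (metis insert_is_Un null_sets.Un)
  qed
  \<comment> \<open>A point \<open>\<omega>\<close> outside all these sets would select functionals of norm 1 that, even after
    multiplication by \<open>2 ^ k\<close>, remain bounded at each \<open>smul b a\<close>.\<close>
  have "{0..1} \<subseteq> (\<Union>a\<in>A. Z a)"
  proof (rule ccontr)
    assume "\<not> ?thesis"
    then obtain \<omega> where \<omega>: "\<omega> \<in> {0..1}" "\<And>a. a \<in> A \<Longrightarrow> \<omega> \<notin> Z a" by blast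
    have "A \<noteq> {}" using inf[of "{}"] by (auto simp: L_def)
    then have \<omega>1: "\<omega> \<in> {0..<1}" using \<omega> by (auto simp: Z_def less_le)
    define \<phi> where "\<phi> = (\<lambda>k. 2 ^ k *\<^sub>R f k (ix k \<omega>))"
    have "\<exists>C. \<forall>k. \<bar>\<phi> k (smul b a)\<bar> \<le> C" if "a \<in> A" "b \<in> Basis" for a b
    proof -
      let ?x = "smul b a"
      have "\<omega> \<notin> bad ?x" using \<omega>(2)[OF that(1)] that(2) by (auto simp: Z_def)
      then have "\<forall>\<^sub>\<infinity>k. \<bar>f k (ix k \<omega>) ?x\<bar> \<le> (1 / 2) ^ k * norm ?x"
        using \<omega>1 by (auto simp: bad_def not_INFM not_less)
      then obtain m where "\<And>k. m \<le> k \<Longrightarrow> \<bar>f k (ix k \<omega>) ?x\<bar> \<le> (1 / 2) ^ k * norm ?x"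
        by (auto simp: MOST_nat_le)
      then have tail: "\<bar>\<phi> k ?x\<bar> \<le> norm ?x" if "m \<le> k" for k
        using that by (simp add: \<phi>_def blinfun.scaleR_left abs_mult field_simps)
      have "\<bar>\<phi> k ?x\<bar> \<le> norm ?x + (\<Sum>j<m. \<bar>\<phi> j ?x\<bar>)" for k
      proof (cases "m \<le> k")
        case True
        then show ?thesis using tail[of k] by (simp add: add_increasing2 sum_nonneg)
      next
        case False
        then have "\<bar>\<phi> k ?x\<bar> \<le> (\<Sum>j<m. \<bar>\<phi> j ?x\<bar>)"
          by (intro member_le_sum) auto
        then show ?thesis by (simp add: add_increasing)
      qed
      then show ?thesis by blast
    qed
    then obtain K where K: "\<And>k. norm_on L (\<phi> k) \<le> K"
      using V.barrelled_uniform_boundedness[OF assms(4)] unfolding L_def by metis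
    have "2 ^ k \<le> K" for k :: nat
      using K[of k] f[OF ix[OF \<omega>1, of k]] norm_on_scaleR[OF L, of "2 ^ k" "f k (ix k \<omega>)"]
      by (simp add: \<phi>_def)
    moreover obtain k :: nat where "K < 2 ^ k" using real_arch_pow[of 2 K] by auto
    ultimately show False by (meson not_less)
  qed
  moreover have "Z a \<subseteq> {0..1}" for a by (auto simp: Z_def bad_def)
  ultimately have "Z ` A \<in> null_covers"
    using Z by (auto simp: null_covers_def)
  then have "cov_null \<le>o |Z ` A|" using cov_null_minimal by auto
  also have "|Z ` A| \<le>o |A|" by (rule card_of_image)
  finally show ?thesis .
qed

end
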